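(* Let $X$ be a reflexive real Banach space with dual $X^\ast$, let $S\colon X\rightrightarrows X^\ast$ be maximally monotone, let $h\in\mathcal{H}(S)$, and let $T\colon X\rightrightarrows X^\ast$ be a point-to-set operator. Let $x\in\operatorname{dom} S$ and $y\in\operatorname{dom} T$. Then the following hold: (i) $\mathcal{D}_T^{\sharp,h}(\cdot,y)$ is convex. (ii) If $T$ is an affine mapping, then $\mathcal{D}_T^{h}(x,\cdot)$ is convex.
   Context: For a maximally monotone operator $S\colon X\rightrightarrows X^\ast$ with graph $\mathcal{G}(S)$, a function $h\colon X\times X^\ast\to\left]-\infty,+\infty\right]$ represents $S$, written $h\in\mathcal{H}(S)$, if (a) $h$ is convex and norm $\times$ weak$^\ast$ lower semicontinuous; (b) $h(x,v)\geq\langle x,v\rangle$ for all $(x,v)\in X\times X^\ast$; (c) $h(x,v)=\langle x,v\rangle$ if and only if $(x,v)\in\mathcal{G}(S)$. For an operator $A$, $\operatorname{dom} A=\{x: Ax\neq\varnothing\}$. Generalized Bregman distances: for $(x,y)\in\operatorname{dom} S\times\operatorname{dom} T$, $$\mathcal{D}_T^{\flat,h}(x,y):=\inf_{v\in Ty}\big(h(x,v)-\langle x,v\rangle\big),\qquad \mathcal{D}_T^{\sharp,h}(x,y):=\sup_{v\in Ty}\big(h(x,v)-\langle x,v\rangle\big),$$ and both are set equal to $+\infty$ if $x\notin\operatorname{dom} S$ or $y\notin\operatorname{dom} T$. When $T$ is point-to-point, $\mathcal{D}_T^{h}:=\mathcal{D}_T^{\flat,h}=\mathcal{D}_T^{\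sharp,h}$.
   Formalization: Since dom S need not be convex, (i) as stated can fail; it is proved as the convexity inequality whenever both end points and the intermediate point lie in dom S, and as convexity on all of X when dom S is convex. *)

theory Defs
  imports "HOL-Analysis.Analysis"
begin

type_synonym 'a dual = "'a \<Rightarrow>\<^sub>L real"

text \<open>A point-to-set operator from X to its dual is a function \<open>'a \<Rightarrow> 'a dual set\<close>;
  the pairing of \<open>x\<close> and \<open>v\<close> is \<open>blinfun_apply v x\<close>.\<close>

definition bidual_embedding :: "'a::real_normed_vector \<Rightarrow> 'a dual dual" where
  "bidual_embedding x = Blinfun (\<lambda>v. blinfun_apply v x)"

lemma bidual_embedding_apply [simp]:
  "blinfun_apply (bidual_embedding x) v = blinfun_apply v x"
  unfolding bidual_embedding_def
  by (simp add: bounded_linear_Blinfun_apply blinfun.bounded_linear_left)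

definition reflexive_space :: "'a::real_normed_vector itself \<Rightarrow> bool" where
  "reflexive_space _ \<longleftrightarrow> surj (bidual_embedding :: 'a \<Rightarrow> 'a dual dual)"

definition op_dom :: "('a::real_normed_vector \<Rightarrow> 'a dual set) \<Rightarrow> 'a set" where
  "op_dom A = {x. A x \<noteq> {}}"

definition op_graph :: "('a::real_normed_vector \<Rightarrow> 'a dual set) \<Rightarrow> ('a \<times> 'a dual) set" where
  "op_graph A = {(x, v). v \<in> A x}"

definition monotone_op :: "('a::real_normed_vector \<Rightarrow> 'a dual set) \<Rightarrow> bool" where
  "monotone_op A \<longleftrightarrow>
     (\<forall>x u y v. (x, u) \<in> op_graph A \<longrightarrow> (y, v) \<in> op_graph A \<longrightarrow> 0 \<le> blinfun_apply (u - v) (x - y))"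

definition maximally_monotone :: "('a::real_normed_vector \<Rightarrow> 'a dual set) \<Rightarrow> bool" where
  "maximally_monotone A \<longleftrightarrow>
     monotone_op A \<and> (\<forall>B. monotone_op B \<longrightarrow> op_graph A \<subseteq> op_graph B \<longrightarrow> op_graph B = op_graph A)"

text \<open>Jensen's inequality for an extended-real function on a set \<open>C\<close>. The set \<open>C\<close> need not be
  convex: the inequality is required whenever both end points and the intermediate point lie
  in \<open>C\<close>. With \<open>C = UNIV\<close> this is the usual convexity of a function on the whole space.\<close>

definition ereal_convex_on :: "'a::real_vector set \<Rightarrow> ('a \<Rightarrow> ereal) \<Rightarrow> bool" where
  "ereal_convex_on C f \<longleftrightarrow>
     (\<forall>x\<in>C. \<forall>y\<in>C. \<forall>t::real. 0 \<le> t \<longrightarrow> t \<le> 1 \<longrightarrow> (1 - t) *\<^sub>R x + t *\<^sub>R y \<in> C \<longrightarrow>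
        f ((1 - t) *\<^sub>R x + t *\<^sub>R y) \<le> ereal (1 - t) * f x + ereal t * f y)"

definition lower_semicontinuous_in :: "'b topology \<Rightarrow> ('b \<Rightarrow> ereal) \<Rightarrow> bool" where
  "lower_semicontinuous_in X f \<longleftrightarrow> (\<forall>c::ereal. openin X {p \<in> topspace X. c < f p})"

text \<open>On the dual space (operators into the reals) \<open>strong_operator_topology\<close>, the topology of
  pointwise convergence, is the weak-star topology.\<close>

definition norm_weak_star_topology :: "('a::real_normed_vector \<times> 'a dual) topology" where
  "norm_weak_star_topology = prod_topology euclidean strong_operator_topology"

definition represents ::
    "('a::real_normed_vector \<times> 'a dual \<Rightarrow> ereal) \<Rightarrow> ('a \<Rightarrow> 'a dual set) \<Rightarrow> bool" where
  "represents h S \<longleftrightarrow>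
     (\<forall>p. h p \<noteq> -\<infinity>) \<and>
     ereal_convex_on UNIV h \<and>
     lower_semicontinuous_in norm_weak_star_topology h \<and>
     (\<forall>x v. ereal (blinfun_apply v x) \<le> h (x, v)) \<and>
     (\<forall>x v. h (x, v) = ereal (blinfun_apply v x) \<longleftrightarrow> (x, v) \<in> op_graph S)"

definition bregman_flat ::
    "('a::real_normed_vector \<Rightarrow> 'a dual set) \<Rightarrow> ('a \<times> 'a dual \<Rightarrow> ereal) \<Rightarrow>
     ('a \<Rightarrow> 'a dual set) \<Rightarrow> 'a \<Rightarrow> 'a \<Rightarrow> ereal" where
  "bregman_flat S h T x y =
     (if x \<in> op_dom S \<and> y \<in> op_dom T
      then INF v\<in>T y. h (x, v) - ereal (blinfun_apply v x) else \<infinity>)"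

definition bregman_sharp ::
    "('a::real_normed_vector \<Rightarrow> 'a dual set) \<Rightarrow> ('a \<times> 'a dual \<Rightarrow> ereal) \<Rightarrow>
     ('a \<Rightarrow> 'a dual set) \<Rightarrow> 'a \<Rightarrow> 'a \<Rightarrow> ereal" where
  "bregman_sharp S h T x y =
     (if x \<in> op_dom S \<and> y \<in> op_dom T
      then SUP v\<in>T y. h (x, v) - ereal (blinfun_apply v x) else \<infinity>)"

definition point_to_point :: "('a::real_normed_vector \<Rightarrow> 'a dual set) \<Rightarrow> bool" where
  "point_to_point T \<longleftrightarrow> (\<forall>y\<in>op_dom T. \<exists>v. T y = {v})"

text \<open>Only meaningful for point-to-point \<open>T\<close>, where it is the common value of the two
  distances (next lemma).\<close>

definition bregman_dist ::
    "('a::real_normed_vector \<Rightarrow> 'a dual set) \<Rightarrow> ('a \<times> 'a dual \<Rightarrow> ereal) \<Rightarrow>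
     ('a \<Rightarrow> 'a dual set) \<Rightarrow> 'a \<Rightarrow> 'a \<Rightarrow> ereal" where
  "bregman_dist S h T = bregman_flat S h T"

lemma bregman_dist_eq:
  assumes "point_to_point T"
  shows "bregman_dist S h T = bregman_flat S h T" "bregman_dist S h T = bregman_sharp S h T"
proof -
  have "bregman_flat S h T x y = bregman_sharp S h T x y" for x y
    using assms unfolding point_to_point_def bregman_flat_def bregman_sharp_def by force
  then show "bregman_dist S h T = bregman_flat S h T" "bregman_dist S h T = bregman_sharp S h T"
    by (auto simp: bregman_dist_def fun_eq_iff)
qed

text \<open>A point-to-point operator preserving affine combinations. Its domain is allowed to be a
  proper affine subspace; mappings defined on all of X are the case \<open>op_dom T = UNIV\<close>.\<close>

definition affine_mapping :: "('a::real_normed_vector \<Rightarrow> 'a dual set) \<Rightarrow> bool" where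
  "affine_mapping T \<longleftrightarrow>
     point_to_point T \<and>
     (\<forall>x y u v. \<forall>t::real. u \<in> T x \<longrightarrow> v \<in> T y \<longrightarrow>
        (1 - t) *\<^sub>R u + t *\<^sub>R v \<in> T ((1 - t) *\<^sub>R x + t *\<^sub>R y))"

end

theory Submission
  imports Defs
begin

text \<open>The gap \<open>h (x, v)\<close> minus the pairing of \<open>x\<close> and
  \<open>v\<close> is nonnegative. Subtracting a bilinear pairing can destroy joint convexity, but
  with \<open>x\<close> or \<open>v\<close> fixed the pairing is affine, so the gap inherits
  convexity from \<open>h\<close> (\<open>represents_gap_convex\<close>). For (i), fix
  \<open>v\<close> in \<open>T y\<close>: the sharp distance is a supremum of functions convex in
  the first argument. For (ii), fix \<open>x\<close>: the distance is a convex gap composed with the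
  affine map \<open>T\<close>. Both arguments work on the effective domain; extending by \<infinity>
  keeps convexity if that domain is convex. This is automatic for an affine \<open>T\<close>, and an
  explicit premise for \<open>op_dom S\<close>, since the domain of a maximally monotone operator
  may fail to be convex.\<close>

lemma ereal_convex_on_UNIV_if_infinite_outside:
  fixes C :: "'a::real_vector set"
  assumes conv: "ereal_convex_on C f" and C: "convex C"
    and nonneg: "\<And>x. 0 \<le> f x" and out: "\<And>x. x \<notin> C \<Longrightarrow> f x = \<infinity>"
  shows "ereal_convex_on UNIV f"
  unfolding ereal_convex_on_def
proof (intro ballI allI impI)
  fix x y :: 'a and t :: real
  assume t: "0 \<le> t" "t \<le> 1"
  let ?z = "(1 - t) *\<^sub>R x + t *\<^sub>R y"
  \<comment> \<open>The end points are split off because \<open>0 * \<infinity> = 0\<close> in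
    \<open>ereal\<close>: an endpoint of weight zero outside \<open>C\<close> does not make the
    right-hand side infinite.\<close>
  consider "t = 0" | "t = 1" | "0 < t" "t < 1" "x \<in> C" "y \<in> C"
    | "0 < t" "t < 1" "x \<notin> C \<or> y \<notin> C"
    using t by linarith
  then show "f ?z \<le> ereal (1 - t) * f x + ereal t * f y"
  proof cases
    case 3
    then have "?z \<in> C" using C by (simp add: convex_alt)
    then show ?thesis using 3 conv by (simp add: ereal_convex_on_def)
  next
    case 4
    have "0 \<le> ereal (1 - t) * f x" "0 \<le> ereal t * f y"
      using t nonneg by simp_all
    moreover have "ereal (1 - t) * f x = \<infinity> \<or> ereal t * f y = \<infinity>"
      using 4 out[of x] out[of y] by auto
    ultimately have "ereal (1 - t) * f x + ereal t * f y = \<infinity>" by auto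
    then show ?thesis by (simp only: ereal_less_eq)
  qed (simp_all add: zero_ereal_def[symmetric] one_ereal_def[symmetric])
qed

lemma represents_gap_nonneg:
  assumes "represents h S"
  shows "0 \<le> h (x, v) - ereal (blinfun_apply v x)"
  using assms by (simp add: represents_def ereal_diff_positive)

text \<open>The pairing is only bilinear, so the gap is convex just along segments on which the
  pairing happens to be affine; these include the segments with one component constant.\<close>

lemma represents_gap_convex:
  assumes rep: "represents h S" and t: "0 \<le> t" "t \<le> 1"
    and x: "x = (1 - t) *\<^sub>R x1 + t *\<^sub>R x2" and v: "v = (1 - t) *\<^sub>R v1 + t *\<^sub>R v2"
    and aff: "blinfun_apply v x = (1 - t) * blinfun_apply v1 x1 + t * blinfun_apply v2 x2"
  shows "h (x, v) - ereal (blinfun_apply v x) \<le>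
    ereal (1 - t) * (h (x1, v1) - ereal (blinfun_apply v1 x1)) +
    ereal t * (h (x2, v2) - ereal (blinfun_apply v2 x2))"
proof -
  have "h ((1 - t) *\<^sub>R (x1, v1) + t *\<^sub>R (x2, v2))
      \<le> ereal (1 - t) * h (x1, v1) + ereal t * h (x2, v2)"
    using rep t unfolding represents_def ereal_convex_on_def by blast
  then have le: "h (x, v) \<le> ereal (1 - t) * h (x1, v1) + ereal t * h (x2, v2)"
    by (simp add: x v)
  have fin: "h p \<noteq> -\<infinity>" for p using rep unfolding represents_def by blast
  have "h (x, v) - ereal (blinfun_apply v x) \<le>
      (ereal (1 - t) * h (x1, v1) + ereal t * h (x2, v2)) - ereal (blinfun_apply v x)"
    using le by (rule ereal_minus_mono) simp
  \<comment> \<open>By \<open>aff\<close> the pairing splits along the two terms. Since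
    \<open>h\<close> never takes the value \<open>-\<infinity>\<close>, no undefined difference
    arises; \<open>t = 0\<close> and \<open>t = 1\<close> are again separate because of
    \<open>0 * \<infinity> = 0\<close>.\<close>
  also have "\<dots> = ereal (1 - t) * (h (x1, v1) - ereal (blinfun_apply v1 x1)) +
      ereal t * (h (x2, v2) - ereal (blinfun_apply v2 x2))"
    using fin[of "(x1, v1)"] fin[of "(x2, v2)"] t unfolding aff
    by (cases "h (x1, v1)"; cases "h (x2, v2)"; cases "t = 0"; cases "t = 1")
      (auto simp: algebra_simps zero_ereal_def[symmetric])
  finally show ?thesis .
qed

lemma bregman_flat_nonneg:
  assumes "represents h S"
  shows "0 \<le> bregman_flat S h T x y"
  using represents_gap_nonneg[OF assms] by (auto simp: bregman_flat_def intro!: INF_greatest)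

lemma bregman_sharp_nonneg:
  assumes "represents h S"
  shows "0 \<le> bregman_sharp S h T x y"
proof (cases "x \<in> op_dom S \<and> y \<in> op_dom T")
  case True
  \<comment> \<open>A witness is needed: the supremum over an empty set would be
    \<open>-\<infinity>\<close>.\<close>
  then obtain v where "v \<in> T y" by (auto simp: op_dom_def)
  then have "0 \<le> (SUP v\<in>T y. h (x, v) - ereal (blinfun_apply v x))"
    using represents_gap_nonneg[OF assms] by (rule SUP_upper2)
  then show ?thesis using True by (simp add: bregman_sharp_def)
next
  case False
  then show ?thesis by (auto simp: bregman_sharp_def)
qed

text \<open>For each fixed \<open>v\<close> the gap obeys Jensen's inequality, and bounding its
  right-hand side by the sharp distances makes the bound independent of \<open>v\<close>, so the
  supremum can be taken on the left.\<close>

lemma bregman_sharp_convex_left: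
  assumes rep: "represents h S" and y: "y \<in> op_dom T"
  shows "ereal_convex_on (op_dom S) (\<lambda>z. bregman_sharp S h T z y)"
  unfolding ereal_convex_on_def
proof (intro ballI allI impI)
  fix x1 x2 and t :: real
  assume S: "x1 \<in> op_dom S" "x2 \<in> op_dom S" and t: "0 \<le> t" "t \<le> 1"
  let ?x = "(1 - t) *\<^sub>R x1 + t *\<^sub>R x2"
  assume x: "?x \<in> op_dom S"
  have "h (?x, v) - ereal (blinfun_apply v ?x) \<le>
      ereal (1 - t) * bregman_sharp S h T x1 y + ereal t * bregman_sharp S h T x2 y"
    if v: "v \<in> T y" for v
  proof -
    have ub: "h (z, v) - ereal (blinfun_apply v z) \<le> bregman_sharp S h T z y"
      if "z \<in> op_dom S" for z
      using that y v by (auto simp: bregman_sharp_def intro: SUP_upper)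
    \<comment> \<open>Here \<open>v1 = v2 = v\<close>, and the pairing is affine because
      \<open>v\<close> is linear.\<close>
    have "h (?x, v) - ereal (blinfun_apply v ?x) \<le>
        ereal (1 - t) * (h (x1, v) - ereal (blinfun_apply v x1)) +
        ereal t * (h (x2, v) - ereal (blinfun_apply v x2))"
      using rep t by (rule represents_gap_convex)
        (simp_all add: scaleR_left_distrib[symmetric] blinfun.add_right blinfun.scaleR_right)
    also have "\<dots> \<le> ereal (1 - t) * bregman_sharp S h T x1 y
        + ereal t * bregman_sharp S h T x2 y"
      using t ub S by (intro add_mono ereal_mult_left_mono) simp_all
    finally show ?thesis .
  qed
  then have "(SUP v\<in>T y. h (?x, v) - ereal (blinfun_apply v ?x)) \<le>
      ereal (1 - t) * bregman_sharp S h T x1 y + ereal t * bregman_sharp S h T x2 y"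
    by (rule SUP_least)
  then show "bregman_sharp S h T ?x y \<le>
      ereal (1 - t) * bregman_sharp S h T x1 y + ereal t * bregman_sharp S h T x2 y"
    using x y by (simp add: bregman_sharp_def[of S h T ?x y])
qed

lemma affine_mapping_convex_dom:
  assumes "affine_mapping T"
  shows "convex (op_dom T)"
  using assms unfolding convex_alt affine_mapping_def op_dom_def by blast

lemma bregman_dist_convex_right:
  assumes rep: "represents h S" and T: "affine_mapping T" and x: "x \<in> op_dom S"
  shows "ereal_convex_on (op_dom T) (\<lambda>z. bregman_dist S h T x z)"
  unfolding ereal_convex_on_def
proof (intro ballI allI impI)
  fix y1 y2 and t :: real
  assume Y: "y1 \<in> op_dom T" "y2 \<in> op_dom T" and t: "0 \<le> t" "t \<le> 1"
  let ?y = "(1 - t) *\<^sub>R y1 + t *\<^sub>R y2"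
  assume y: "?y \<in> op_dom T"
  have single: "\<exists>v. T z = {v}" if "z \<in> op_dom T" for z
    using T that by (simp add: affine_mapping_def point_to_point_def)
  obtain v1 where v1: "T y1 = {v1}" using single[OF Y(1)] ..
  obtain v2 where v2: "T y2 = {v2}" using single[OF Y(2)] ..
  let ?v = "(1 - t) *\<^sub>R v1 + t *\<^sub>R v2"
  have "v1 \<in> T y1" "v2 \<in> T y2" by (simp_all add: v1 v2)
  then have "?v \<in> T ?y" using T unfolding affine_mapping_def by blast
  \<comment> \<open>Affinity gives only membership of \<open>?v\<close>; single-valuedness at
    \<open>?y\<close> turns it into equality.\<close>
  moreover obtain w where "T ?y = {w}" using single[OF y] ..
  ultimately have Ty: "T ?y = {?v}" by simp
  have dist: "bregman_dist S h T x z = h (x, w) - ereal (blinfun_apply w x)"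
    if "T z = {w}" for z w
    using that x by (simp add: bregman_dist_def bregman_flat_def op_dom_def)
  show "bregman_dist S h T x ?y \<le>
      ereal (1 - t) * bregman_dist S h T x y1 + ereal t * bregman_dist S h T x y2"
    unfolding dist[OF Ty] dist[OF v1] dist[OF v2]
    using rep t by (rule represents_gap_convex)
      (simp_all add: scaleR_left_distrib[symmetric] blinfun.add_left blinfun.scaleR_left)
qed

theorem proposition4p1:
  fixes S T :: "'a::banach \<Rightarrow> 'a dual set"
    and h :: "'a \<times> 'a dual \<Rightarrow> ereal"
    and x y :: 'a
  assumes "reflexive_space TYPE('a)"
    and "maximally_monotone S"
    and "represents h S"
    and "x \<in> op_dom S"
    and "y \<in> op_dom T"
  shows "(ereal_convex_on (op_dom S) (\<lambda>z. bregman_sharp S h T z y) \<and>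
          (convex (op_dom S) \<longrightarrow> ereal_convex_on UNIV (\<lambda>z. bregman_sharp S h T z y))) \<and>
         (affine_mapping T \<longrightarrow> ereal_convex_on UNIV (\<lambda>z. bregman_dist S h T x z))"
proof (intro conjI impI)
  show left: "ereal_convex_on (op_dom S) (\<lambda>z. bregman_sharp S h T z y)"
    using assms(3,5) by (rule bregman_sharp_convex_left)
  show "ereal_convex_on UNIV (\<lambda>z. bregman_sharp S h T z y)" if "convex (op_dom S)"
    using left that bregman_sharp_nonneg[OF assms(3)]
    by (rule ereal_convex_on_UNIV_if_infinite_outside) (simp add: bregman_sharp_def)
  show "ereal_convex_on UNIV (\<lambda>z. bregman_dist S h T x z)" if T: "affine_mapping T"
    using bregman_dist_convex_right[OF assms(3) T assms(4)] affine_mapping_convex_dom[OF T]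
    by (rule ereal_convex_on_UNIV_if_infinite_outside)
      (simp_all add: bregman_dist_def bregman_flat_nonneg[OF assms(3)], simp add: bregman_flat_def)
qed

end
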